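(* Let $d\ge 3$ be odd and let $P$ be a $d$-polytope that is Gale and braxial with respect to the vertex array $x_0<x_1<\cdots<x_n$, where $n\ge d+1$. Then $P$ is a cyclic $d$-polytope with respect to $x_0<x_1<\cdots<x_n$.
   Context: All polytopes are convex. $[y_1,\ldots,y_s]$ denotes the convex hull of $\{y_1,\ldots,y_s\}$. A vertex array of a polytope is a total ordering $x_0<x_1<\cdots<x_n$ of its full vertex set ($x_i<x_j$ iff $i<j$). The vertex array of a face is the induced ordering. Gale: if $X$ is a totally ordered finite set, $Y\subset X$ is a Gale subset if any two points of $X\setminus Y$ have an even number of points of $Y$ strictly between them. A $d$-polytope is Gale with respect to a vertex array if the vertex set of each of its facets is a Gale subset of the vertex set. A polytope is cyclic with respect to a vertex array if it is simplicial and Gale with respect to that vertex array. Braxtope: for $e\ge 3$, an $e$-polytope $Q$ with vertex array $y_0<y_1<\cdots<y_m$, $m\ge e$, is an $e$-braxtope (with respect to this array) if its set of facets is exactly $\{T_0,\ldots,T_{m-e+1},E_2,\ldots,E_m\}$, where $T_i=[y_i,y_{i+1},\ldots,y_{i+e-1}]$ for $0\le i\le m-e+1$ and $E_j=[y_0,y_{j-e+2},\ldots,y_{j-1},y_{j+1},\ldots,y_{j+e-2}]$ for $2\le j\le m$, with the convention $y_t=y_0$ for $t\le 0$ and $y_t=y_m$ for $t\ge m$. For $0\le e\le 2$ an $e$-braxtope is an $e$-simplex. A $d$-polytope is braxial with respect to a vertex array if each of its facets is a $(d-1)$-braxtope with respect to the induced ordering. *)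

theory Defs
  imports "HOL-Analysis.Analysis"
begin

definition dim_polytope :: "nat \<Rightarrow> 'a::euclidean_space set \<Rightarrow> bool" where
  "dim_polytope d P \<longleftrightarrow> polytope P \<and> aff_dim P = int d"

definition vertices :: "'a::euclidean_space set \<Rightarrow> 'a set" where
  "vertices P = {v. v extreme_point_of P}"

(* A total ordering x_0 < ... < x_n of the vertices is the list [x_0, ..., x_n]. *)
definition vertex_array :: "'a::euclidean_space list \<Rightarrow> 'a set \<Rightarrow> bool" where
  "vertex_array xs P \<longleftrightarrow> distinct xs \<and> set xs = vertices P"

definition induced_array :: "'a::euclidean_space list \<Rightarrow> 'a set \<Rightarrow> 'a list" where
  "induced_array xs F = filter (\<lambda>v. v \<in> vertices F) xs"

(* The totally ordered set X is given by the distinct list xs. *)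
definition gale_subset :: "'a list \<Rightarrow> 'a set \<Rightarrow> bool" where
  "gale_subset xs Y \<longleftrightarrow> Y \<subseteq> set xs \<and>
     (\<forall>i k. i < k \<and> k < length xs \<and> xs ! i \<notin> Y \<and> xs ! k \<notin> Y \<longrightarrow>
        even (card {j. i < j \<and> j < k \<and> xs ! j \<in> Y}))"

definition gale :: "nat \<Rightarrow> 'a::euclidean_space set \<Rightarrow> 'a list \<Rightarrow> bool" where
  "gale d P xs \<longleftrightarrow> dim_polytope d P \<and> vertex_array xs P \<and>
     (\<forall>F. F facet_of P \<longrightarrow> gale_subset xs (vertices F))"

definition simplicial :: "nat \<Rightarrow> 'a::euclidean_space set \<Rightarrow> bool" where
  "simplicial d P \<longleftrightarrow> dim_polytope d P \<and> (\<forall>F. F facet_of P \<longrightarrow> (int d - 1) simplex F)"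

definition cyclic :: "nat \<Rightarrow> 'a::euclidean_space set \<Rightarrow> 'a list \<Rightarrow> bool" where
  "cyclic d P xs \<longleftrightarrow> simplicial d P \<and> gale d P xs"

(* For ys = [y_0, ..., y_m]: y_t, where y_t = y_0 for t <= 0 and y_t = y_m for t >= m. *)
definition clipped_nth :: "'a list \<Rightarrow> int \<Rightarrow> 'a" where
  "clipped_nth ys t = ys ! nat (max 0 (min t (int (length ys) - 1)))"

definition brax_T :: "nat \<Rightarrow> 'a::euclidean_space list \<Rightarrow> nat \<Rightarrow> 'a set" where
  "brax_T e ys i = convex hull ((!) ys ` {i..i + e - 1})"

(* The index j is omitted before clipping, so y_m still occurs in E_m (as y_(m+1)). *)
definition brax_E :: "nat \<Rightarrow> 'a::euclidean_space list \<Rightarrow> nat \<Rightarrow> 'a set" where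
  "brax_E e ys j = convex hull (insert (ys ! 0)
     (clipped_nth ys ` ({int j - int e + 2..int j + int e - 2} - {int j})))"

definition braxtope :: "nat \<Rightarrow> 'a::euclidean_space set \<Rightarrow> 'a list \<Rightarrow> bool" where
  "braxtope e Q ys \<longleftrightarrow> vertex_array ys Q \<and>
     (if e \<le> 2 then int e simplex Q
      else dim_polytope e Q \<and>
        (\<exists>m. length ys = m + 1 \<and> e \<le> m \<and>
           {F. F facet_of Q} = brax_T e ys ` {0..m - e + 1} \<union> brax_E e ys ` {2..m}))"

definition braxial :: "nat \<Rightarrow> 'a::euclidean_space set \<Rightarrow> 'a list \<Rightarrow> bool" where
  "braxial d P xs \<longleftrightarrow> dim_polytope d P \<and> vertex_array xs P \<and>
     (\<forall>F. F facet_of P \<longrightarrow> braxtope (d - 1) F (induced_array xs F))"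

end

theory Submission
  imports Defs
begin

text \<open>Put \<open>e = d - 1\<close>, which is even, and call a facet with more than \<open>d\<close> vertices large. A ridge of \<open>P\<close>
  lies in exactly two facets; if it has more than \<open>e\<close> vertices, both are large and the ridge is some
  \<open>E\<^sub>l\<close> with \<open>3 \<le> l \<le> k - 2\<close> of the second one. Let \<open>F\<close> be large with vertices \<open>y\<^sub>0 < \<dots> < y\<^sub>m\<close>.
  Gale parity in the two facets on the ridge \<open>E\<^sub>3\<close> forces \<open>y\<^sub>0 = x\<^sub>0\<close>. The other facet on
  \<open>T\<^bsub>m-e\<^esub>\<close> then avoids \<open>x\<^sub>0\<close>, so it has \<open>d\<close> vertices; as \<open>d\<close> is odd it must contain \<open>x\<^sub>n\<close>, hence
  \<open>y\<^sub>m \<noteq> x\<^sub>n\<close>. Finally, if \<open>y\<^sub>m\<close> is as large as possible, then parity in the two facets on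
  \<open>E\<^bsub>m-e+2\<^esub>\<close> is contradictory. So no facet is large.\<close>

section \<open>Braxtope facets as sets of vertex indices\<close>

definition brax_index_T :: "nat \<Rightarrow> nat \<Rightarrow> nat set" where
  "brax_index_T e i = {i..<i + e}"

text \<open>The disjunct \<open>j = m\<close> accounts for \<open>y\<^bsub>m+1\<^esub> = y\<^sub>m\<close> in \<open>E\<^sub>m\<close>; no other clipped index contributes
  a new vertex.\<close>
definition brax_index_E :: "nat \<Rightarrow> nat \<Rightarrow> nat \<Rightarrow> nat set" where
  "brax_index_E e m j =
     {i. i \<le> m \<and> (i = 0 \<or> i \<noteq> j \<and> j + 2 \<le> i + e \<and> i + 2 \<le> j + e \<or> j = m \<and> i = m)}"

definition brax_index_sets :: "nat \<Rightarrow> nat \<Rightarrow> nat set set" where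
  "brax_index_sets e m = brax_index_T e ` {0..m - e + 1} \<union> brax_index_E e m ` {2..m}"

text \<open>Vertices are identified with their positions \<open>0, \<dots>, n\<close> in the array.\<close>
definition gale_nat :: "nat \<Rightarrow> nat set \<Rightarrow> bool" where
  "gale_nat n A \<longleftrightarrow>
     (\<forall>i k. i < k \<and> k \<le> n \<and> i \<notin> A \<and> k \<notin> A \<longrightarrow> even (card (A \<inter> {i<..<k})))"

lemma gale_natD:
  "\<lbrakk>gale_nat n A; i < k; k \<le> n; i \<notin> A; k \<notin> A\<rbrakk> \<Longrightarrow> even (card (A \<inter> {i<..<k}))"
  by (simp add: gale_nat_def)

lemma strict_mono_on_atMost_less_iff:
  fixes y :: "nat \<Rightarrow> nat"
  assumes "strict_mono_on {..m} y" "a \<le> m" "b \<le> m"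
  shows "y a < y b \<longleftrightarrow> a < b"
  using assms by (metis atMost_iff linorder_neqE_nat order_less_asym strict_mono_onD)

lemma card_strict_mono_image:
  fixes y :: "nat \<Rightarrow> nat"
  assumes "strict_mono_on {..m} y" "R \<subseteq> {..m}"
  shows "card (y ` R) = card R"
  using assms strict_mono_on_imp_inj_on inj_on_subset card_image by metis

text \<open>Reads off from a common ridge which vertices of one facet belong to the other.\<close>

lemma image_mem_iff_of_Int:
  assumes "inj_on z S" "R \<subseteq> S" "A \<inter> z ` S = z ` R" "i \<in> S"
  shows "z i \<in> A \<longleftrightarrow> i \<in> R"
  using assms inj_on_image_mem_iff[of z S i R] by blast

lemma brax_index_E_subset: "brax_index_E e m j \<subseteq> {..m}"
  by (auto simp: brax_index_E_def)

lemma brax_index_sets_subset: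
  assumes "e \<le> m" "R \<in> brax_index_sets e m"
  shows "R \<subseteq> {..m}"
  using assms by (auto simp: brax_index_sets_def brax_index_T_def brax_index_E_def)

section \<open>Ridges with more than \<open>e\<close> vertices\<close>

lemma card_brax_index_E_lower:
  assumes "4 \<le> e" "e < m"
  shows "card (brax_index_E e m 3) = e + 1"
proof -
  have "brax_index_E e m 3 = {..e+1} - {3}"
    using assms by (auto simp: brax_index_E_def)
  then show ?thesis using assms by simp
qed

text \<open>For \<open>?j\<close> the window \<open>?j - e + 2, ..., ?j + e - 2\<close> ends exactly
  at \<open>m\<close>. By \<open>4 \<le> e\<close> it reaches down at least to
  \<open>?j - 2 = m - e > 0\<close>, which gives \<open>e\<close> indices besides \<open>?j\<close>;
  index 0 is one more.\<close>

lemma card_brax_index_E_upper: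
  assumes "4 \<le> e" "e < m"
  shows "e < card (brax_index_E e m (m - e + 2))"
proof -
  let ?j = "m - e + 2"
  have sub: "insert 0 ({?j-2..m} - {?j}) \<subseteq> brax_index_E e m ?j"
    using assms by (auto simp: brax_index_E_def)
  have fin: "finite (brax_index_E e m ?j)"
    by (rule finite_subset[of _ "{..m}"]) (auto simp: brax_index_E_def)
  have "card (insert 0 ({?j-2..m} - {?j})) = e + 1"
    using assms by (simp add: card_Diff_singleton_if card_insert_if)
  then show ?thesis using card_mono[OF fin sub] by simp
qed

text \<open>Each \<open>T\<close> has only \<open>e\<close> indices, and near either end of the
  array truncation leaves at most \<open>e\<close> indices in \<open>E\<close>. For
  \<open>k = e\<close> there are only \<open>e + 1\<close> indices in all, and \<open>l\<close> is
  left out.\<close>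

lemma large_brax_index_set:
  assumes "4 \<le> e" "e \<le> k" "R \<in> brax_index_sets e k" "e < card R"
  obtains l where "R = brax_index_E e k l" "3 \<le> l" "l + 2 \<le> k" "e < k"
proof -
  have "R \<notin> brax_index_T e ` {0..k - e + 1}"
    using assms(4) by (auto simp: brax_index_T_def)
  then obtain l where l: "2 \<le> l" "l \<le> k" and R: "R = brax_index_E e k l"
    using assms(3) by (auto simp: brax_index_sets_def)
  have bound: "card R \<le> card S" if "R \<subseteq> S" "finite S" for S
    using that card_mono by blast
  have "l \<noteq> 2"
  proof
    assume "l = 2"
    then have "R \<subseteq> {..e} - {2}" using R assms(1,2) by (auto simp: brax_index_E_def)
    from bound[OF this] show False using assms(1,4) by simp
  qed
  moreover have "l < k - 1"
  proof (rule ccontr)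
    assume "\<not> l < k - 1"
    \<comment> \<open>At most \<open>e - 2\<close> indices of the window lie below \<open>l\<close>;
      above it only \<open>k\<close> can occur, and for \<open>l = k\<close> clipping brings
      \<open>k\<close> back.\<close>
    then have "R \<subseteq> insert 0 (insert k {l - (e - 2)..<l})"
      using R l by (auto simp: brax_index_E_def)
    from bound[OF this] have "card R \<le> card (insert 0 (insert k {l - (e - 2)..<l}))" by simp
    also have "\<dots> \<le> e"
      using assms(1) l by (auto simp: card_insert_if)
    finally show False using assms(4) by simp
  qed
  moreover have "e < k"
  proof (rule ccontr)
    assume "\<not> e < k"
    then have "R \<subseteq> {..e} - {l}" using R l \<open>l < k - 1\<close> by (auto simp: brax_index_E_def)
    from bound[OF this] show False using assms(4) l \<open>\<not> e < k\<close> by simp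
  qed
  ultimately show ?thesis using that R l by simp
qed

section \<open>Gale parity in two facets on a common ridge\<close>

text \<open>If \<open>y 0 \<noteq> 0\<close>, position 0 is missing from both facets, and parity
  counts starting at 0 force their first three vertices to agree. The vertex \<open>y 3\<close>,
  omitted from the ridge, is then a gap of the second facet with exactly three of its vertices
  below.\<close>

lemma large_contains_least:
  fixes y z :: "nat \<Rightarrow> nat"
  assumes y: "strict_mono_on {..m} y" "gale_nat n (y ` {..m})" "y m \<le> n"
    and z: "strict_mono_on {..k} z" "gale_nat n (z ` {..k})" "z k \<le> n"
    and e: "4 \<le> e" "e < m" and l: "3 \<le> l" "l + 2 \<le> k"
    and int: "y ` {..m} \<inter> z ` {..k} = y ` brax_index_E e m 3"
    and eq: "z ` brax_index_E e k l = y ` brax_index_E e m 3"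
  shows "y 0 = 0"
proof (rule ccontr)
  assume "y 0 \<noteq> 0"
  note ly = strict_mono_on_atMost_less_iff[OF y(1)]
  note lz = strict_mono_on_atMost_less_iff[OF z(1)]
  have iy: "inj_on y {..m}" and iz: "inj_on z {..k}"
    using y(1) z(1) strict_mono_on_imp_inj_on by blast+
  have zA: "z i \<in> y ` {..m} \<longleftrightarrow> i \<in> brax_index_E e k l" if "i \<le> k" for i
    using image_mem_iff_of_Int[OF iz brax_index_E_subset int[folded eq]] that by simp
  have yB: "y i \<in> z ` {..k} \<longleftrightarrow> i \<in> brax_index_E e m 3" if "i \<le> m" for i
    using image_mem_iff_of_Int[OF iy brax_index_E_subset, of "z ` {..k}"] int that
    by (simp add: Int_commute)
  have B: "y 0 \<in> z ` {..k}" "y 1 \<in> z ` {..k}" "y 2 \<in> z ` {..k}" "y 3 \<notin> z ` {..k}"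
    using e by (simp_all add: yB, simp_all add: brax_index_E_def)
  \<comment> \<open>Index 0 belongs to every \<open>E\<close>, so the least vertex of each facet
    lies on the ridge.\<close>
  have z0: "z 0 = y 0"
  proof -
    obtain i where i: "i \<le> k" "y 0 = z i" using B(1) by auto
    obtain a where a: "a \<le> m" "z 0 = y a" using zA[of 0] by (auto simp: brax_index_E_def)
    have "\<not> y a < y 0" using ly[of a 0] a by simp
    moreover have "\<not> z i < z 0" using lz[of i 0] i by simp
    ultimately show ?thesis using i a by simp
  qed
  have A0: "0 \<notin> y ` {..m}"
  proof
    assume "0 \<in> y ` {..m}"
    then obtain i where "i \<le> m" "y i = 0" by auto
    then show False using ly[of i 0] \<open>y 0 \<noteq> 0\<close> by simp
  qed
  have B0: "0 \<notin> z ` {..k}"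
  proof
    assume "0 \<in> z ` {..k}"
    then obtain i where "i \<le> k" "z i = 0" by auto
    then show False using lz[of i 0] z0 \<open>y 0 \<noteq> 0\<close> by simp
  qed
  \<comment> \<open>A gap right after the vertex with index \<open>p\<close> has
    \<open>p + 1\<close> vertices of the first facet between it and the missing position 0.\<close>
  have count_y: "even (p + 1)" if "p < m" "w \<notin> y ` {..m}" "y p < w" "w < y (p + 1)" for p w
  proof -
    have "y (p + 1) \<le> y m" using ly[of m "p+1"] that by simp
    then have wn: "w \<le> n" using that y(3) by simp
    have "y ` {..m} \<inter> {0<..<w} = y ` {..p}"
    proof (intro equalityI subsetI)
      fix x assume "x \<in> y ` {..m} \<inter> {0<..<w}"
      then obtain i where i: "i \<le> m" "x = y i" "y i < w" by auto
      then have "y i < y (p+1)" using that by simp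
      with i show "x \<in> y ` {..p}" using ly[of i "p+1"] that by simp
    next
      fix x assume "x \<in> y ` {..p}"
      then obtain i where i: "i \<le> p" "x = y i" by auto
      then have "y i \<le> y p" "y i \<in> y ` {..m}" using ly[of p i] that by simp_all
      then show "x \<in> y ` {..m} \<inter> {0<..<w}"
        using i that A0 by (cases "y i = 0") auto
    qed
    then show ?thesis
      using gale_natD[OF y(2), of 0 w] wn that A0 card_strict_mono_image[OF y(1), of "{..p}"]
      by simp
  qed
  have z1: "z 1 = y 1"
  proof -
    obtain i where i: "i \<le> k" "y 1 = z i" using B(2) by auto
    have "y 0 < y 1" using ly[of 0 1] e by simp
    then have "i \<noteq> 0" using z0 i by (cases i) auto
    then have "z 1 \<le> y 1" using lz[of i 1] i by simp
    moreover have "y 0 < z 1" using z0 lz[of 0 1] l by simp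
    \<comment> \<open>Otherwise \<open>z 1\<close> would be a gap of the first facet preceded by a
      single vertex.\<close>
    moreover have "z 1 \<in> y ` {..m}"
      using count_y[of 0 "z 1"] calculation e by (cases "z 1 = y 1") auto
    then obtain a where a: "a \<le> m" "z 1 = y a" by auto
    ultimately show ?thesis using ly[of 0 a] ly[of a 1] e by (cases "a = 1") auto
  qed
  have z2: "z 2 = y 2"
  proof -
    obtain i where i: "i \<le> k" "y 2 = z i" using B(3) by auto
    have "z 1 < z i" using z1 i ly[of 1 2] e by simp
    then have "z 2 \<le> y 2" using lz[of 1 i] lz[of i 2] i l by simp
    have "1 \<in> brax_index_E e k l" using zA[of 1] z1 l e by auto
    \<comment> \<open>The window containing 1 starts no later than 1, and \<open>3 \<le> l\<close>
      keeps 2 from being the omitted index.\<close>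
    then have "2 \<in> brax_index_E e k l" using l e by (auto simp: brax_index_E_def)
    then obtain a where a: "a \<le> m" "z 2 = y a" using zA[of 2] l by auto
    have "y 1 < y a" using z1 a lz[of 1 2] l by simp
    then show ?thesis using a \<open>z 2 \<le> y 2\<close> ly[of 1 a] ly[of a 2] e by (cases "a = 2") auto
  qed
  \<comment> \<open>Otherwise \<open>z 3\<close> would fall strictly between \<open>y 2\<close> and
    \<open>y 3\<close>, a gap of the first facet preceded by three vertices.\<close>
  have z3: "y 3 < z 3"
  proof (rule ccontr)
    assume "\<not> y 3 < z 3"
    then have "z 3 < y 3" using B(4) l by (metis atMost_iff imageI linorder_neqE_nat add_leE le_trans)
    moreover have "y 2 < z 3" using z2 lz[of 2 3] l by simp
    moreover have "z 3 \<notin> y ` {..m}"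
    proof
      assume "z 3 \<in> y ` {..m}"
      then obtain a where "a \<le> m" "z 3 = y a" by auto
      then show False using calculation ly[of 2 a] ly[of a 3] e by simp
    qed
    ultimately show False using count_y[of 2 "z 3"] e by simp
  qed
  have "z ` {..k} \<inter> {0<..<y 3} = z ` {..2}"
  proof (intro equalityI subsetI)
    fix x assume "x \<in> z ` {..k} \<inter> {0<..<y 3}"
    then obtain i where i: "i \<le> k" "x = z i" "z i < z 3" using z3 by auto
    then show "x \<in> z ` {..2}" using lz[of i 3] l by simp
  next
    fix x assume "x \<in> z ` {..2}"
    then obtain i where i: "i \<le> 2" "x = z i" by auto
    then have "z i \<le> z 2" "z i \<in> z ` {..k}" using lz[of 2 i] l by simp_all
    moreover have "y 2 < y 3" using ly[of 2 3] e by simp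
    ultimately show "x \<in> z ` {..k} \<inter> {0<..<y 3}"
      using i z2 B0 by (cases "z i = 0") auto
  qed
  moreover have "y 3 \<le> n" using ly[of m 3] e y(3) by simp
  moreover have "0 < y 3" using ly[of 0 3] e by simp
  ultimately show False
    using gale_natD[OF z(2), of 0 "y 3"] B0 B(4) card_strict_mono_image[OF z(1), of "{..2}"] l
    by simp
qed

text \<open>Since \<open>e < m\<close>, this ridge omits both end indices 0 and \<open>m\<close>. If
  \<open>y m = n\<close>, the second facet thus misses positions 0 and \<open>n\<close>, and all its
  \<open>e + 1\<close> positions, an odd number, lie strictly between them.\<close>

lemma large_greatest_less:
  fixes y z :: "nat \<Rightarrow> nat"
  assumes y: "strict_mono_on {..m} y" "y m \<le> n" "y 0 = 0"
    and z: "strict_mono_on {..e} z" "gale_nat n (z ` {..e})" "z e \<le> n"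
    and e: "even e" "e < m"
    and int: "y ` {..m} \<inter> z ` {..e} = y ` brax_index_T e (m - e)"
  shows "y m < n"
proof (rule ccontr)
  assume "\<not> y m < n"
  then have yn: "y m = n" using y(2) by simp
  have iy: "inj_on y {..m}"
    using y(1) strict_mono_on_imp_inj_on by blast
  have yB: "y i \<in> z ` {..e} \<longleftrightarrow> i \<in> brax_index_T e (m - e)" if "i \<le> m" for i
  proof (rule image_mem_iff_of_Int[OF iy])
    show "brax_index_T e (m - e) \<subseteq> {..m}" using e by (auto simp: brax_index_T_def)
  qed (use int that in \<open>simp_all add: Int_commute\<close>)
  have B: "0 \<notin> z ` {..e}" "n \<notin> z ` {..e}"
    using yB[of 0] yB[of m] e y(3) yn by (auto simp: brax_index_T_def)
  have z_max: "z i \<le> z e" if "i \<le> e" for i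
    using strict_mono_on_atMost_less_iff[OF z(1), of e i] that by simp
  have "z ` {..e} \<inter> {0<..<n} = z ` {..e}"
  proof (intro equalityI subsetI)
    fix x assume x: "x \<in> z ` {..e}"
    then have "x \<le> z e" using z_max by auto
    moreover have "x \<noteq> 0 \<and> x \<noteq> n" using x B by metis
    ultimately show "x \<in> z ` {..e} \<inter> {0<..<n}" using x z(3) by simp
  qed simp
  moreover have "0 < n"
    using strict_mono_on_atMost_less_iff[OF y(1), of 0 m] e yn by simp
  ultimately show False
    using gale_natD[OF z(2), of 0 n] B e card_strict_mono_image[OF z(1), of "{..e}"] by simp
qed

text \<open>If \<open>z k \<le> y m\<close>, the greatest vertices coincide. The two omitted
  vertices, \<open>y j\<close> with \<open>j = m - e + 2\<close> and \<open>z l\<close>, are each a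
  gap of the other facet. The smaller one and the gap \<open>n\<close> enclose \<open>e - 1\<close>
  vertices of the facet missing it, an odd number; the only alternative violates the size of the
  ridge.\<close>

lemma large_greatest_increases:
  fixes y z :: "nat \<Rightarrow> nat"
  assumes y: "strict_mono_on {..m} y" "gale_nat n (y ` {..m})" "y m < n"
    and z: "strict_mono_on {..k} z" "gale_nat n (z ` {..k})" "z k < n"
    and e: "4 \<le> e" "even e" "e < m" and l: "3 \<le> l" "l + 2 \<le> k"
    and int: "y ` {..m} \<inter> z ` {..k} = y ` brax_index_E e m (m - e + 2)"
    and eq: "z ` brax_index_E e k l = y ` brax_index_E e m (m - e + 2)"
  shows "y m < z k"
proof (rule ccontr)
  assume "\<not> y m < z k"
  \<comment> \<open>For this \<open>j\<close> the window ends exactly at \<open>m\<close>: so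
    \<open>y m\<close> is on the ridge, and \<open>e - 2\<close> ridge vertices lie above
    \<open>y j\<close>.\<close>
  define j where "j = m - e + 2"
  have j: "3 \<le> j" "j + 2 \<le> m" "m + 2 = j + e" using e by (auto simp: j_def)
  note int = int[folded j_def] and eq = eq[folded j_def]
  note ly = strict_mono_on_atMost_less_iff[OF y(1)]
  note lz = strict_mono_on_atMost_less_iff[OF z(1)]
  have iy: "inj_on y {..m}" and iz: "inj_on z {..k}"
    using y(1) z(1) strict_mono_on_imp_inj_on by blast+
  have zA: "z i \<in> y ` {..m} \<longleftrightarrow> i \<in> brax_index_E e k l" if "i \<le> k" for i
    using image_mem_iff_of_Int[OF iz brax_index_E_subset int[folded eq]] that by simp
  have yB: "y i \<in> z ` {..k} \<longleftrightarrow> i \<in> brax_index_E e m j" if "i \<le> m" for i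
    using image_mem_iff_of_Int[OF iy brax_index_E_subset, of "z ` {..k}"] int that
    by (simp add: Int_commute)
  have zk_max: "z i \<le> z k" if "i \<le> k" for i using lz[of k i] that by simp
  have ym_max: "y i \<le> y m" if "i \<le> m" for i using ly[of m i] that by simp
  have "y m \<in> z ` {..k}" using yB[of m] j by (auto simp: brax_index_E_def)
  then have zk: "z k = y m" using zk_max \<open>\<not> y m < z k\<close> by (auto intro: antisym)
  have "k \<in> brax_index_E e k l" using zA[of k] zk by auto
  \<comment> \<open>As \<open>l + 2 \<le> k\<close>, the index \<open>k\<close> belongs to the ridge
    through the window and not through clipping.\<close>
  then have kl: "k + 2 \<le> l + e" using l by (auto simp: brax_index_E_def)
  have "l \<notin> brax_index_E e k l" using l by (auto simp: brax_index_E_def)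
  then have zlA: "z l \<notin> y ` {..m}" using zA[of l] l by simp
  have yjB: "y j \<notin> z ` {..k}" using yB[of j] j by (auto simp: brax_index_E_def)
  have above: "y ` brax_index_E e m j \<inter> {y j<..} = y ` {j<..m}"
  proof (intro equalityI subsetI)
    fix x assume "x \<in> y ` brax_index_E e m j \<inter> {y j<..}"
    then obtain i where "i \<in> brax_index_E e m j" "x = y i" "y j < y i" by auto
    then show "x \<in> y ` {j<..m}" using ly[of j i] j by (auto simp: brax_index_E_def)
  next
    fix x assume "x \<in> y ` {j<..m}"
    then obtain i where "j < i" "i \<le> m" "x = y i" by auto
    then show "x \<in> y ` brax_index_E e m j \<inter> {y j<..}"
      using ly[of j i] j by (auto simp: brax_index_E_def)
  qed
  have card_above: "card (y ` {j<..m}) = e - 2"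
    using card_strict_mono_image[OF y(1), of "{j<..m}"] j by force
  show False
  proof (cases "y j < z l")
    case True
    \<comment> \<open>\<open>i\<close> is the first index of the second facet beyond its gap
      \<open>y j\<close>.\<close>
    define i where "i = (LEAST i. y j < z i)"
    have i: "y j < z i" "i \<le> l"
      unfolding i_def using True by (auto intro: LeastI Least_le)
    have i_le: "y j < z a \<longleftrightarrow> i \<le> a" if "a \<le> k" for a
    proof
      show "y j < z a \<Longrightarrow> i \<le> a" unfolding i_def by (rule Least_le)
      show "i \<le> a \<Longrightarrow> y j < z a" using i lz[of a i] that by (cases "a = i") auto
    qed
    have "z ` {..k} \<inter> {y j<..<n} = z ` {i..k}"
      using i_le zk_max z(3) by (force simp: order.strict_trans1)
    then have even: "even (card {i..k})"
      using gale_natD[OF z(2), of "y j" n] y(3) ym_max[of j] j yjB z(3) zk_max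
        card_strict_mono_image[OF z(1), of "{i..k}"] by (force simp: not_le[symmetric])
    have "z ` (brax_index_E e k l \<inter> {i..k}) = y ` {j<..m}"
      unfolding above[symmetric] eq[symmetric] using i_le by (auto simp: brax_index_E_def)
    then have card: "card (brax_index_E e k l \<inter> {i..k}) = e - 2"
      using card_above card_strict_mono_image[OF z(1), of "brax_index_E e k l \<inter> {i..k}"]
      by (metis Int_lower1 brax_index_E_subset subset_trans)
    \<comment> \<open>Index 0 lies in \<open>E\<close> regardless of the window; once it is
      excluded, the window alone describes the intersection.\<close>
    have "i \<noteq> 0"
    proof
      assume "i = 0"
      obtain a where "a \<le> k" "y 0 = z a" using yB[of 0] by (auto simp: brax_index_E_def)
      then have "y j < y 0" using i_le[of a] \<open>i = 0\<close> by simp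
      then show False using ly[of j 0] j by simp
    qed
    then have E: "brax_index_E e k l \<inter> {i..k} = {max i (l + 2 - e)..<l} \<union> {l<..k}"
      using kl l i by (auto simp: brax_index_E_def)
    have c: "e - 2 = l - max i (l + 2 - e) + (k - l)"
      unfolding card[symmetric] E by (subst card_Un_disjoint) auto
    \<comment> \<open>If the window starts by \<open>i\<close>, only \<open>l\<close> is missing
      from \<open>{i..k}\<close>, which then has \<open>e - 1\<close> elements, an odd number.
      Otherwise the \<open>e - 2\<close> window indices below \<open>l\<close> already exhaust the
      count, leaving no room for the \<open>k - l \<ge> 2\<close> above it.\<close>
    show False
    proof (cases "l + 2 - e \<le> i")
      case True
      then have "e - 2 = k - i" using c i l by simp
      then have "card {i..k} = e - 1" using i l e by simp
      then show False using even e by simp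
    next
      case False
      then show False using c l by simp
    qed
  next
    case False
    then have "z l < y j" using yjB l by (metis atMost_iff imageI linorder_neqE_nat add_leE)
    \<comment> \<open>Ridge vertices above \<open>y j\<close> lie above \<open>z l\<close>; since
      \<open>k - l \<le> e - 2\<close>, counting turns this inclusion into equality.\<close>
    have "y ` {j<..m} \<subseteq> z ` {l<..k}"
    proof
      fix x assume "x \<in> y ` {j<..m}"
      then have "x \<in> z ` brax_index_E e k l" "y j < x" using above eq by blast+
      then obtain a where "a \<le> k" "x = z a" "z l < z a"
        using \<open>z l < y j\<close> by (auto simp: brax_index_E_def)
      then show "x \<in> z ` {l<..k}" using lz[of l a] l by simp
    qed
    moreover have "card (z ` {l<..k}) = k - l"
      using card_strict_mono_image[OF z(1), of "{l<..k}"] by force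
    ultimately have eq2: "y ` {j<..m} = z ` {l<..k}"
      using card_above kl by (intro card_subset_eq) (auto intro: antisym dest: card_mono[rotated])
    have "j - 1 \<in> brax_index_E e m j" using j e by (auto simp: brax_index_E_def)
    then obtain a where a: "a \<le> k" "y (j - 1) = z a"
      using yB[of "j - 1"] j by fastforce
    \<comment> \<open>If the ridge vertex \<open>y (j - 1)\<close> were above \<open>z l\<close>,
      the equality would place it among the vertices above \<open>y j\<close>. Hence
      \<open>y j\<close> is the first vertex of the first facet beyond its gap
      \<open>z l\<close>.\<close>
    have yj1: "y (j - 1) < z l"
    proof (rule ccontr)
      assume "\<not> y (j - 1) < z l"
      moreover have "y (j - 1) \<noteq> z l" using zlA j by (metis atMost_iff imageI diff_le_self add_leE le_trans)
      ultimately have "y (j - 1) \<in> z ` {l<..k}" using a lz[of l a] l by simp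
      then have "y (j - 1) \<in> y ` {j<..m}" unfolding eq2 .
      then obtain b where "y (j - 1) = y b" "b \<in> {j<..m}" by (rule imageE)
      moreover from this have "j - 1 < b" "j - 1 \<le> m" "b \<le> m" using j by auto
      ultimately show False using ly[of "j - 1" b] by simp
    qed
    have "y ` {..m} \<inter> {z l<..<n} = y ` {j..m}"
    proof (intro equalityI subsetI)
      fix x assume "x \<in> y ` {..m} \<inter> {z l<..<n}"
      then obtain b where "b \<le> m" "x = y b" "y (j - 1) < y b" using yj1 by auto
      moreover have "j - 1 \<le> m" using j by simp
      ultimately have "j \<le> b" using ly[of "j - 1" b] by simp
      then show "x \<in> y ` {j..m}" using \<open>b \<le> m\<close> \<open>x = y b\<close> by simp
    next
      fix x assume "x \<in> y ` {j..m}"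
      then obtain b where b: "j \<le> b" "b \<le> m" "x = y b" by auto
      then have "y j \<le> y b" using ly[of b j] by simp
      then show "x \<in> y ` {..m} \<inter> {z l<..<n}"
        using b \<open>z l < y j\<close> ym_max[of b] y(3) by auto
    qed
    moreover have "card (y ` {j..m}) = e - 1"
      using card_strict_mono_image[OF y(1), of "{j..m}"] j by force
    moreover have "n \<notin> y ` {..m}" using ym_max y(3) by force
    moreover have "z l < n" using zk_max[of l] z(3) l by simp
    ultimately show False using gale_natD[OF y(2), of "z l" n] zlA e by simp
  qed
qed

section \<open>Extremal argument over large facets\<close>

text \<open>The combinatorial core, free of geometry: \<open>y F\<close> lists the positions of the
  vertices of a facet, and \<open>ridge\<close> says that each of its ridges is cut out by a second
  facet, of which it is again a ridge.\<close>

lemma gale_brax_family_small: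
  fixes m :: "'f \<Rightarrow> nat" and y :: "'f \<Rightarrow> nat \<Rightarrow> nat"
  assumes e: "4 \<le> e" "even e"
    and mono: "\<And>F. F \<in> \<F> \<Longrightarrow> strict_mono_on {..m F} (y F)"
    and ub: "\<And>F. F \<in> \<F> \<Longrightarrow> y F (m F) \<le> n"
    and gale: "\<And>F. F \<in> \<F> \<Longrightarrow> gale_nat n (y F ` {..m F})"
    and m: "\<And>F. F \<in> \<F> \<Longrightarrow> e \<le> m F"
    and ridge: "\<And>F R. F \<in> \<F> \<Longrightarrow> R \<in> brax_index_sets e (m F) \<Longrightarrow>
      \<exists>G\<in>\<F>. \<exists>R'\<in>brax_index_sets e (m G).
        y F ` {..m F} \<inter> y G ` {..m G} = y F ` R \<and> y G ` R' = y F ` R"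
    and F: "F \<in> \<F>"
  shows "m F = e"
proof (rule ccontr)
  assume "m F \<noteq> e"
  define L where "L = {F\<in>\<F>. e < m F}"
  \<comment> \<open>The facet across a ridge with more than \<open>e\<close> vertices is itself
    large, so the argument stays within \<open>L\<close>.\<close>
  have L_ridge: "\<exists>G\<in>L. \<exists>l. 3 \<le> l \<and> l + 2 \<le> m G \<and>
      y F ` {..m F} \<inter> y G ` {..m G} = y F ` brax_index_E e (m F) j \<and>
      y G ` brax_index_E e (m G) l = y F ` brax_index_E e (m F) j"
    if "F \<in> L" "j \<in> {2..m F}" "e < card (brax_index_E e (m F) j)" for F j
  proof -
    have F: "F \<in> \<F>" using that by (simp add: L_def)
    have "brax_index_E e (m F) j \<in> brax_index_sets e (m F)"
      using that by (simp add: brax_index_sets_def)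
    from ridge[OF F this] obtain G R' where G: "G \<in> \<F>" "R' \<in> brax_index_sets e (m G)"
      and 1: "y F ` {..m F} \<inter> y G ` {..m G} = y F ` brax_index_E e (m F) j"
      and 2: "y G ` R' = y F ` brax_index_E e (m F) j" by blast
    have R': "R' \<subseteq> {..m G}"
      by (rule brax_index_sets_subset[OF m[OF G(1)] G(2)])
    have "card R' = card (y G ` R')" using card_strict_mono_image[OF mono[OF G(1)] R'] by simp
    also have "\<dots> = card (brax_index_E e (m F) j)"
      unfolding 2 by (rule card_strict_mono_image[OF mono[OF F]]) (auto simp: brax_index_E_def)
    finally have "e < card R'" using that(3) by simp
    show ?thesis
    proof -
      obtain l where l: "R' = brax_index_E e (m G) l" "3 \<le> l" "l + 2 \<le> m G" "e < m G"
        using large_brax_index_set[OF e(1) m[OF G(1)] G(2) \<open>e < card R'\<close>] by blast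
      then have "G \<in> L" using G(1) by (simp add: L_def)
      then show ?thesis using l(2,3) 1 2[unfolded l(1)] by (intro bexI[of _ G] exI[of _ l] conjI)
    qed
  qed
  have least: "y F 0 = 0" if F: "F \<in> L" for F
  proof -
    have "3 \<in> {2..m F}" using F e by (auto simp: L_def)
    moreover have "e < card (brax_index_E e (m F) 3)"
      using card_brax_index_E_lower[of e "m F"] F e by (auto simp: L_def)
    ultimately have "\<exists>G\<in>L. \<exists>l. 3 \<le> l \<and> l + 2 \<le> m G \<and>
        y F ` {..m F} \<inter> y G ` {..m G} = y F ` brax_index_E e (m F) 3 \<and>
        y G ` brax_index_E e (m G) l = y F ` brax_index_E e (m F) 3"
      by (rule L_ridge[OF F])
    then obtain G l where G: "G \<in> L" "3 \<le> l" "l + 2 \<le> m G"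
        "y F ` {..m F} \<inter> y G ` {..m G} = y F ` brax_index_E e (m F) 3"
        "y G ` brax_index_E e (m G) l = y F ` brax_index_E e (m F) 3"
      by (elim bexE exE conjE)
    have "F \<in> \<F>" "G \<in> \<F>" "e < m F" using F G by (auto simp: L_def)
    then show ?thesis
      using large_contains_least[OF mono gale ub mono gale ub e(1) _ G(2-5)] by simp
  qed
  have greatest: "y F (m F) < n" if F: "F \<in> L" for F
  proof -
    have F': "F \<in> \<F>" "e < m F" using F by (auto simp: L_def)
    have "brax_index_T e (m F - e) \<in> brax_index_sets e (m F)"
      by (auto simp: brax_index_sets_def)
    from ridge[OF F'(1) this] obtain G where G: "G \<in> \<F>"
      and 1: "y F ` {..m F} \<inter> y G ` {..m G} = y F ` brax_index_T e (m F - e)" by blast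
    \<comment> \<open>Two large facets share position 0, but this ridge omits index 0.\<close>
    have "m G = e"
    proof (rule ccontr)
      assume "m G \<noteq> e"
      then have "G \<in> L" using m[OF G] G by (simp add: L_def)
      then have "y G 0 = y F 0" using least F by simp
      then have "y F 0 \<in> y F ` {..m F} \<inter> y G ` {..m G}" by (metis IntI atMost_iff imageI le0)
      then obtain i where "i \<in> brax_index_T e (m F - e)" "y F 0 = y F i" using 1 by auto
      then show False
        using strict_mono_on_atMost_less_iff[OF mono[OF F'(1)], of 0 i] F'
        by (auto simp: brax_index_T_def)
    qed
    then show ?thesis
      using large_greatest_less[OF mono[OF F'(1)] ub[OF F'(1)] least[OF F], of e "y G"]
        mono[OF G] gale[OF G] ub[OF G] e F' 1 by simp
  qed
  have "F \<in> L" using F m[OF F] \<open>m F \<noteq> e\<close> by (simp add: L_def)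
  moreover have "\<forall>F. F \<in> L \<longrightarrow> y F (m F) < n" using greatest by blast
  \<comment> \<open>The greatest positions are bounded by \<open>n\<close>, so some large facet
    attains the maximum.\<close>
  ultimately obtain F where F: "F \<in> L" and max: "\<And>G. G \<in> L \<Longrightarrow> y G (m G) \<le> y F (m F)"
    using ex_has_greatest_nat[of "\<lambda>F. F \<in> L" F "\<lambda>F. y F (m F)" n] by auto
  have F': "F \<in> \<F>" "e < m F" using F by (auto simp: L_def)
  have "m F - e + 2 \<in> {2..m F}" using F' e by auto
  then have "\<exists>G\<in>L. \<exists>l. 3 \<le> l \<and> l + 2 \<le> m G \<and>
      y F ` {..m F} \<inter> y G ` {..m G} = y F ` brax_index_E e (m F) (m F - e + 2) \<and>
      y G ` brax_index_E e (m G) l = y F ` brax_index_E e (m F) (m F - e + 2)"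
    using card_brax_index_E_upper[OF e(1) F'(2)] by (rule L_ridge[OF F])
  then obtain G l where G: "G \<in> L" "3 \<le> l" "l + 2 \<le> m G"
      "y F ` {..m F} \<inter> y G ` {..m G} = y F ` brax_index_E e (m F) (m F - e + 2)"
      "y G ` brax_index_E e (m G) l = y F ` brax_index_E e (m F) (m F - e + 2)"
    by (elim bexE exE conjE)
  have G': "G \<in> \<F>" using G by (auto simp: L_def)
  have "y F (m F) < y G (m G)"
    using large_greatest_increases[OF mono[OF F'(1)] gale[OF F'(1)] greatest[OF F]
        mono[OF G'] gale[OF G'] greatest[OF G(1)] e F'(2) G(2-5)] .
  then show False using max[OF G(1)] by simp
qed

section \<open>Facets, ridges and vertices of polytopes\<close>

lemma facet_face_of_eq:
  assumes "F facet_of P" "G facet_of P" "F face_of G"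
  shows "F = G"
proof (rule ccontr)
  assume "F \<noteq> G"
  moreover have "convex G" using assms(2) facet_of_imp_face_of face_of_imp_convex by blast
  ultimately have "aff_dim F < aff_dim G" using face_of_aff_dim_lt assms(3) by blast
  then show False using assms(1,2) by (simp add: facet_of_def)
qed

text \<open>A proper nonempty face is the intersection of the facets containing it, so
  \<open>R \<noteq> F\<close> yields another facet \<open>G\<close> containing \<open>R\<close>. As
  a proper face of \<open>F\<close>, \<open>F \<inter> G\<close> has dimension at most that of its
  face \<open>R\<close>, hence equals it.\<close>

lemma polytope_ridge_two_facets:
  fixes P :: "'a::euclidean_space set"
  assumes P: "polytope P" and F: "F facet_of P" and R: "R facet_of F"
  obtains G where "G facet_of P" "F \<inter> G = R" "R facet_of G"
proof -
  have FP: "F face_of P" and RF: "R face_of F" and dims: "aff_dim F = aff_dim P - 1" "aff_dim R = aff_dim F - 1"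
    and "R \<noteq> {}"
    using F R by (auto simp: facet_of_def)
  have RP: "R face_of P" using face_of_trans[OF RF FP] .
  have "R \<noteq> P" using dims by auto
  with RP \<open>R \<noteq> {}\<close> have Inter: "R = \<Inter>{G. G facet_of P \<and> R \<subseteq> G}"
    using face_of_polyhedron[OF polytope_imp_polyhedron[OF P]] by blast
  obtain G where G: "G facet_of P" "R \<subseteq> G" "G \<noteq> F"
  proof (rule ccontr)
    assume "\<not> thesis"
    with that have "\<And>G. G facet_of P \<Longrightarrow> R \<subseteq> G \<Longrightarrow> G = F" by blast
    then have "{G. G facet_of P \<and> R \<subseteq> G} = {F}"
      using F face_of_imp_subset[OF RF] by blast
    then have "R = F" using Inter by simp
    then show False using dims by auto
  qed
  have GP: "G face_of P" using G facet_of_imp_face_of by blast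
  have I: "F \<inter> G face_of P" using face_of_Int[OF FP GP] .
  have IF: "F \<inter> G face_of F" and IG: "F \<inter> G face_of G"
    using I face_of_face[OF FP] face_of_face[OF GP] by blast+
  have "F \<inter> G \<noteq> F"
  proof
    assume "F \<inter> G = F"
    then have "F face_of G" using IG by simp
    then show False using facet_face_of_eq[OF F G(1)] G(3) by simp
  qed
  then have "aff_dim (F \<inter> G) < aff_dim F"
    using face_of_aff_dim_lt[OF face_of_imp_convex[OF FP] IF] by blast
  have RI: "R face_of F \<inter> G"
    using RP face_of_face[OF I] G(2) face_of_imp_subset[OF RF] by blast
  have "R = F \<inter> G"
  proof (rule ccontr)
    assume "R \<noteq> F \<inter> G"
    then have "aff_dim R < aff_dim (F \<inter> G)"
      using face_of_aff_dim_lt[OF face_of_imp_convex[OF I] RI] by blast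
    then show False using \<open>aff_dim (F \<inter> G) < aff_dim F\<close> dims by simp
  qed
  moreover have "R facet_of G"
    using RP face_of_face[OF GP] G \<open>R \<noteq> {}\<close> dims by (auto simp: facet_of_def)
  ultimately show ?thesis using that G(1) by blast
qed

lemma vertices_face: "F face_of P \<Longrightarrow> vertices F = vertices P \<inter> F"
  by (auto simp: vertices_def extreme_point_of_face)

text \<open>Extreme points of \<open>P\<close> stay extreme in a smaller convex set containing them,
  and a hull has no extreme points beyond its generators.\<close>

lemma vertices_convex_hull:
  assumes "S \<subseteq> vertices P" "convex P"
  shows "vertices (convex hull S) = S"
proof
  show "vertices (convex hull S) \<subseteq> S"
    unfolding vertices_def by (rule extreme_points_of_convex_hull)
  have "convex hull S \<subseteq> P"
    using assms by (intro hull_minimal) (auto simp: vertices_def extreme_point_of_def)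
  then show "S \<subseteq> vertices (convex hull S)"
    using assms(1) hull_subset[of S convex]
    unfolding vertices_def extreme_point_of_def by blast
qed

text \<open>A polytope is the hull of its vertices, and \<open>e + 1\<close> points spanning
  dimension \<open>e\<close> are affinely independent.\<close>

lemma simplex_if_card_vertices:
  assumes "polytope F" "aff_dim F = int e" "card (vertices F) = e + 1"
  shows "int e simplex F"
proof -
  have F: "F = convex hull (vertices F)"
    unfolding vertices_def by (rule Krein_Milman_Minkowski)
      (use assms(1) in \<open>simp_all add: polytope_imp_compact polytope_imp_convex\<close>)
  have "finite (vertices F)" using assms(3) by (simp add: card_ge_0_finite)
  moreover have "aff_dim (vertices F) = int e"
    using assms(2) F aff_dim_convex_hull by metis
  ultimately have "\<not> affine_dependent (vertices F)"
    using assms(3) by (simp add: affine_independent_iff_card)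
  then show ?thesis using F assms(3) unfolding simplex_def by auto
qed

section \<open>From braxtope facets to index sets\<close>

lemma braxtope_facets:
  assumes "braxtope e Q ys" "3 \<le> e"
  shows "e < length ys"
    and "{F. F facet_of Q} = (\<lambda>R. convex hull ((!) ys ` R)) ` brax_index_sets e (length ys - 1)"
proof -
  obtain m where m: "length ys = m + 1" "e \<le> m"
    and f: "{F. F facet_of Q} = brax_T e ys ` {0..m - e + 1} \<union> brax_E e ys ` {2..m}"
    using assms by (auto simp: braxtope_def)
  show "e < length ys" using m by simp
  have T: "brax_T e ys i = convex hull ((!) ys ` brax_index_T e i)" for i
  proof -
    have "{i..i + e - 1} = {i..<i + e}" using assms(2) by auto
    then show ?thesis by (simp add: brax_T_def brax_index_T_def)
  qed
  have E: "brax_E e ys j = convex hull ((!) ys ` brax_index_E e m j)" if "j \<in> {2..m}" for j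
  proof -
    have "insert 0 ((\<lambda>t. nat (max 0 (min t (int m)))) ` ({int j - int e + 2..int j + int e - 2} - {int j}))
        = brax_index_E e m j" (is "?L = ?R")
    proof (intro equalityI subsetI)
      fix i assume i: "i \<in> ?L"
      show "i \<in> ?R"
      proof (cases "i = 0")
        case False
        with i obtain t where it: "i = nat (max 0 (min t (int m)))"
          and "t \<in> {int j - int e + 2..int j + int e - 2} - {int j}"
          by blast
        then have t: "int j - int e + 2 \<le> t" "t \<le> int j + int e - 2" "t \<noteq> int j" by simp_all
        \<comment> \<open>Clipping sends \<open>t\<close> to 0, leaves it unchanged, or sends it to
          \<open>m\<close>.\<close>
        have "i = 0 \<and> t \<le> 0 \<or> 0 \<le> t \<and> t \<le> int m \<and> t = int i \<or> i = m \<and> int m < t"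
          unfolding it by linarith
        then show ?thesis
        proof (elim disjE conjE)
          assume "0 \<le> t" "t \<le> int m" "t = int i"
          then have "i \<le> m" "i \<noteq> j" "j + 2 \<le> i + e" "i + 2 \<le> j + e"
            using t by linarith+
          then show ?thesis by (simp add: brax_index_E_def)
        next
          assume "i = m" "int m < t"
          then have "j + 2 \<le> i + e" "i + 2 \<le> j + e" using t that assms(2) by auto
          then show ?thesis using \<open>i = m\<close> by (auto simp: brax_index_E_def)
        qed (simp add: brax_index_E_def)
      qed (simp add: brax_index_E_def)
    next
      fix i assume i: "i \<in> ?R"
      \<comment> \<open>An index is its own preimage under clipping unless \<open>i = j\<close>,
        which occurs only for \<open>j = m\<close>; then \<open>m + 1\<close> clips to
        \<open>m\<close> and lies in the window by \<open>3 \<le> e\<close>.\<close>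
      define t where "t = (if i = j then int m + 1 else int i)"
      show "i \<in> ?L"
      proof (cases "i = 0")
        case False
        then have "i = nat (max 0 (min t (int m)))" "t \<in> {int j - int e + 2..int j + int e - 2} - {int j}"
          using i assms(2) by (auto simp: brax_index_E_def t_def)
        then show ?thesis by blast
      qed simp
    qed
    from this[symmetric] have "(!) ys ` brax_index_E e m j = insert (ys ! 0)
       (clipped_nth ys ` ({int j - int e + 2..int j + int e - 2} - {int j}))"
      by (simp add: clipped_nth_def m(1) image_image)
    then show ?thesis by (simp add: brax_E_def)
  qed
  show "{F. F facet_of Q} = (\<lambda>R. convex hull ((!) ys ` R)) ` brax_index_sets e (length ys - 1)"
    using image_cong[OF refl E, of "{2..m}" "\<lambda>j. j"] T m(1)
    by (simp add: f brax_index_sets_def image_Un image_image)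
qed

section \<open>Positions of vertices and the reduction to the combinatorial core\<close>

text \<open>Listing positions instead of points turns the array order into the order of the natural
  numbers, so that Gale parity counts elements of intervals.\<close>

definition positions :: "'a list \<Rightarrow> 'a set \<Rightarrow> nat list" where
  "positions xs V = filter (\<lambda>i. xs ! i \<in> V) [0..<length xs]"

lemma set_positions: "set (positions xs V) = {i. i < length xs \<and> xs ! i \<in> V}"
  by (auto simp: positions_def)

lemma sorted_positions: "sorted_wrt (<) (positions xs V)"
  unfolding positions_def by (intro sorted_wrt_filter) (simp add: sorted_wrt_upt)

lemma filter_eq_map_positions: "filter (\<lambda>v. v \<in> V) xs = map ((!) xs) (positions xs V)"
  by (subst map_nth[of xs, symmetric]) (simp only: filter_map positions_def o_def)

theorem theorem1:
  fixes P :: "'a::euclidean_space set" and xs :: "'a list" and d n :: nat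
  assumes "d \<ge> 3" and "odd d"
    and "dim_polytope d P"
    and "vertex_array xs P" and "length xs = n + 1" and "n \<ge> d + 1"
    and "gale d P xs" and "braxial d P xs"
  shows "cyclic d P xs"
proof -
  have P: "polytope P" "aff_dim P = int d" and xs: "distinct xs" "set xs = vertices P"
    using assms(3,4) by (auto simp: dim_polytope_def vertex_array_def)
  have brax: "braxtope (d - 1) F (induced_array xs F)" if "F facet_of P" for F
    using assms(8) that by (simp add: braxial_def)
  have "(int d - 1) simplex F" if F: "F facet_of P" for F
  proof (cases "d = 3")
    \<comment> \<open>Here the facets are 2-braxtopes, which are simplices by definition.\<close>
    case True
    then show ?thesis using brax[OF F] by (simp add: braxtope_def)
  next
    case False
    define e where "e = d - 1"
    have e: "4 \<le> e" "even e" "int d - 1 = int e"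
      using assms(1,2) False by (auto simp: e_def elim!: oddE)
    define ys where "ys F = positions xs (vertices F)" for F
    define m where "m F = length (ys F) - 1" for F
    have ind: "induced_array xs F = map ((!) xs) (ys F)" for F
      by (simp add: induced_array_def filter_eq_map_positions ys_def)
    have len: "length (ys F) = m F + 1" "e \<le> m F" if "F facet_of P" for F
      using braxtope_facets(1)[OF brax[OF that]] e by (auto simp: ind m_def e_def)
    have vF: "vertices F \<subseteq> set xs" if "F facet_of P" for F
      using vertices_face[OF facet_of_imp_face_of[OF that]] xs by blast
    have img: "(!) (ys F) ` {..m F} = {i. i < length xs \<and> xs ! i \<in> vertices F}"
      if "F facet_of P" for F
    proof -
      have "(!) (ys F) ` {..m F} = set (ys F)"
        using len[OF that] by (auto simp: set_conv_nth less_Suc_eq_le)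
      then show ?thesis by (simp add: ys_def set_positions)
    qed
    have V: "(\<lambda>i. xs ! (ys F ! i)) ` {..m F} = vertices F" if "F facet_of P" for F
      unfolding image_image[of "(!) xs" "(!) (ys F)", symmetric] img[OF that]
      using vF[OF that] by (auto simp: in_set_conv_nth subset_iff)
    have facets: "{K. K facet_of F} =
        (\<lambda>R. convex hull ((\<lambda>i. xs ! (ys F ! i)) ` R)) ` brax_index_sets e (m F)"
      if "F facet_of P" for F
    proof -
      have "(!) (map ((!) xs) (ys F)) ` R = (\<lambda>i. xs ! (ys F ! i)) ` R"
        if "R \<in> brax_index_sets e (m F)" for R
        using len[OF \<open>F facet_of P\<close>] brax_index_sets_subset[OF len(2)[OF \<open>F facet_of P\<close>] that]
        by (intro image_cong) auto
      then show ?thesis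
        using braxtope_facets(2)[OF brax[OF that]] e by (simp add: ind m_def e_def cong: image_cong)
    qed
    have pos: "ys F ! i < length xs" if "F facet_of P" "i \<le> m F" for F i
      using img[OF that(1)] that(2) by blast
    have "m F = e"
    proof (rule gale_brax_family_small[where \<F> = "{F. F facet_of P}" and y = "\<lambda>F. (!) (ys F)" and n = n])
      fix F assume "F \<in> {F. F facet_of P}"
      then have F: "F facet_of P" by simp
      show "strict_mono_on {..m F} ((!) (ys F))"
        using sorted_positions[of xs "vertices F"] len[OF F]
        by (auto simp: strict_mono_on_def ys_def sorted_wrt_iff_nth_less)
      show "ys F ! m F \<le> n" using pos[OF F, of "m F"] assms(5) by simp
      show "e \<le> m F" using len[OF F] by simp
      have "gale_subset xs (vertices F)" using assms(7) F by (simp add: gale_def)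
      moreover have "{j. i < j \<and> j < k \<and> xs ! j \<in> vertices F} = (!) (ys F) ` {..m F} \<inter> {i<..<k}"
        if "k \<le> n" for i k
        using that img[OF F] assms(5) by auto
      ultimately show "gale_nat n ((!) (ys F) ` {..m F})"
        using img[OF F] assms(5) by (auto simp: gale_subset_def gale_nat_def)
    next
      fix F R assume "F \<in> {F. F facet_of P}" and R: "R \<in> brax_index_sets e (m F)"
      then have F: "F facet_of P" by simp
      let ?K = "convex hull ((\<lambda>i. xs ! (ys F ! i)) ` R)"
      have "?K facet_of F" using facets[OF F] R by blast
      then obtain G where G: "G facet_of P" "F \<inter> G = ?K" "?K facet_of G"
        using polytope_ridge_two_facets[OF P(1) F] by blast
      obtain R' where R': "R' \<in> brax_index_sets e (m G)"
        and K': "?K = convex hull ((\<lambda>i. xs ! (ys G ! i)) ` R')"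
        using facets[OF G(1)] G(3) by blast
      \<comment> \<open>The hull determines its index set, since the chosen vertices of
        \<open>F\<close> are exactly its extreme points. Applied to \<open>F\<close> and to
        \<open>G\<close>, this matches the two descriptions of the ridge.\<close>
      have vK: "{i. i < length xs \<and> xs ! i \<in> vertices (convex hull ((\<lambda>i. xs ! (ys F ! i)) ` R))}
          = (!) (ys F) ` R"
        if F: "F facet_of P" and R: "R \<in> brax_index_sets e (m F)" for F R
      proof -
        have sub: "R \<subseteq> {..m F}" using brax_index_sets_subset[OF len(2)[OF F] R] .
        have "vertices (convex hull ((\<lambda>i. xs ! (ys F ! i)) ` R)) = (\<lambda>i. xs ! (ys F ! i)) ` R"
          using V[OF F] sub F
          by (intro vertices_convex_hull[where P = F]) (auto intro: face_of_imp_convex facet_of_imp_face_of)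
        then show ?thesis
          using sub pos[OF F] xs(1) by (auto simp: nth_eq_iff_index_eq subset_iff)
      qed
      \<comment> \<open>The vertices of a face are the vertices of \<open>P\<close> in it, so those
        of \<open>F \<inter> G\<close> are the common ones.\<close>
      have "vertices ?K = vertices F \<inter> vertices G"
        using vertices_face[of "F \<inter> G" P] vertices_face[of F P] vertices_face[of G P]
          face_of_Int[of F P G] F G(1,2) by (auto dest: facet_of_imp_face_of)
      then have "(!) (ys F) ` {..m F} \<inter> (!) (ys G) ` {..m G} = (!) (ys F) ` R"
        unfolding img[OF F] img[OF G(1)] vK[OF F R, symmetric] by blast
      moreover have "(!) (ys G) ` R' = (!) (ys F) ` R"
        using vK[OF F R] vK[OF G(1) R'] K' by simp
      ultimately show "\<exists>G\<in>{F. F facet_of P}. \<exists>R'\<in>brax_index_sets e (m G).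
          (!) (ys F) ` {..m F} \<inter> (!) (ys G) ` {..m G} = (!) (ys F) ` R \<and>
          (!) (ys G) ` R' = (!) (ys F) ` R"
        using G(1) R' by blast
    qed (use e F in auto)
    have "distinct (induced_array xs F)" "set (induced_array xs F) = vertices F"
      using xs(1) vF[OF F] by (auto simp: induced_array_def)
    then have "card (vertices F) = e + 1"
      using distinct_card[of "induced_array xs F"] len[OF F] \<open>m F = e\<close> by (simp add: ind)
    moreover have "polytope F" "aff_dim F = int e"
      using F P e face_of_polytope_polytope by (auto simp: facet_of_def)
    ultimately show ?thesis using simplex_if_card_vertices e(3) by simp
  qed
  then show ?thesis using assms(3,7) by (simp add: cyclic_def simplicial_def)
qed

end
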